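(* Let $K$ be a field of characteristic zero, let $n\leq 7$ and let $(S,c)$ be a maximal admissible pair. Then the canonical linear form $f_{S,c}\in\mathfrak{ut}(n,K)^*$ is contained in the orbit $\Omega_{S,c}$ (all notation as defined in the context).
   Context: Basic notation. $K$ is a field of characteristic zero, $n\ge 2$. $G=\mathrm{UT}(n,K)$ is the group of lower triangular $n\times n$ matrices with $1$'s on the diagonal, $\mathfrak g=\mathfrak{ut}(n,K)$ its Lie algebra of strictly lower triangular matrices, with basis the matrix units $y_{ij}$, $i>j$. $G$ acts on $\mathfrak g^*$ by the coadjoint action. $\Delta^+=\{\alpha_{ji}=\varepsilon_j-\varepsilon_i: 1\le j<i\le n\}$; for $\xi=\alpha_{ji}$ write $y_\xi=y_{ij}$. Order: $\alpha_{ji}>\alpha_{ts}$ iff $j<t$, or $j=t$ and $i>s$. $S(\mathfrak g)=K[\mathfrak g^*]$ carries the Poisson bracket extending $\{x,y\}=[x,y]$, $x,y\in\mathfrak g$. A Poisson ideal is an ideal $I$ with $\{I,S(\mathfrak g)\}\subset I$. Admissible subsets. $A\subset\Delta^+$ is additive if $\alpha,\beta\in A$, $\alpha+\beta\in\Delta^+$ imply $\alpha+\beta\in A$. For additive $A$ and $\xi\in A$ let $C(\xi,A)=\{\gamma\in A:\ \xi-\gamma\in A\}=C_+(\xi,A)\sqcup C_-(\xi,A)$, where $\gamma\in C_+$ if $\gamma>\xi-\gamma$ and $\gamma\in C_-$ if $\gamma<\xi-\gamma$; the set $A(\xi)=A\setminus C(\xi,A)$ is again additive. A subset $S=\{\xi_1>\dots>\xi_k\}\subset\Delta^+$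 is admissible if, with $A_1=\Delta^+$ and $A_{i+1}=A_i(\xi_i)$, one has $\xi_i\in A_i$ for all $i$. Put $A(S)=A_{k+1}$, $M(S)=A(S)\setminus S$. Write $S=S_\otimes\sqcup S_\square$, where $\xi_i\in S_\otimes$ if $C(\xi_i,A_i)\neq\emptyset$ and $\xi_i\in S_\square$ if $C(\xi_i,A_i)=\emptyset$. An admissible $S$ is maximal if $S_\square$ is maximal by inclusion among the sets $S'_\square$ for admissible $S'$ with $S'_\otimes=S_\otimes$. A maximal admissible pair is a pair $(S,c)$ with $S$ maximal admissible and $c:S\to K$ a map with $c(\xi)\ne0$ for $\xi\in S_\otimes$; $\mathcal S_n$ is the set of all such pairs. Extend $c$ to $A(S)$ by $c(\gamma)=0$ for $\gamma\in M(S)$. The canonical form $f_{S,c}\in\mathfrak g^*$ is defined by $f_{S,c}(y_\gamma)=c(\gamma)$ for $\gamma\in A(S)$ and $f_{S,c}(y_\gamma)=0$ for $\gamma\in\Delta^+\setminus A(S)$. The ideals $\mathcal I_{S,c}$ ($n\le 7$). Fix $(S,c)\in\mathcal S_n$. For $1\le t\le n$ put $\Delta^{(t)}=\{\alpha_{ti}:i>t\}$, $m(t)=1+\max\{r:\xi_r\in\Delta^{(1)}\cup\dots\cup\Delta^{(t-1)}\}$ (with $\max\emptyset=0$), $B_t=A_{m(t)}\cap\{\alpha_{ji}: t\le j<i\le n\}$, and $\mathfrak g_t=\mathrm{span}\{y_\gamma:\gamma\in B_t\}$, a Lie subalgebra; $\mathfrak g_1=\mathfrak g$, $\mathfrak g_n=0$.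 Let $I_t$ be the ideal of $S(\mathfrak g_t)$ generated by $y_\gamma-c(\gamma)$, $\gamma\in A(S)\cap\Delta^{(t)}$; it is a Poisson ideal. An injective Poisson homomorphism $\theta_t:S(\mathfrak g_{t+1})\to S(\mathfrak g_t)/I_t$ is defined, for $1\le t\le n-1$, as follows (these cases exhaust all possibilities for $n\le7$). Case 1: $S_\otimes\cap\Delta^{(t)}=\{\xi\}$ and every $\eta\in S_\square\cap\Delta^{(t)}$ satisfies $\eta>\xi$. Write $C_+(\xi,B_t)=\{\gamma_1>\dots>\gamma_k\}$, $\gamma_i'=\xi-\gamma_i$, so $C_-(\xi,B_t)=\{\gamma_1'<\dots<\gamma_k'\}$. For $0\le m\le k$ let $\mathfrak g_t^{(m)}=\mathrm{span}\{y_\eta:\eta\in B_t\setminus\{\gamma'_1,\dots,\gamma'_m\}\}$ and let $I_t^{(m)}$ be the ideal of $S(\mathfrak g_t^{(m)})$ generated by $y_\gamma-c(\gamma)$, $\gamma\in A(S)\cap\Delta^{(t)}$, and $y_{\gamma_1},\dots,y_{\gamma_m}$. With $p=y_{\gamma_m'}$, $q=c(\xi)^{-1}y_{\gamma_m}$, the formula $a\mapsto\sum_{s\ge0}\frac{(-1)^s}{s!}\mathrm{ad}_p^s(a)q^s$ ($\mathrm{ad}_p(a)=\{p,a\}$) induces an injective Poisson map $\theta_{(m)}:S(\mathfrak g_t^{(m)})/I_t^{(m)}\to S(\mathfrak g_t^{(m-1)})/I_t^{(m-1)}$. Since $S(\mathfrak g_t^{(k)})/I_t^{(k)}=S(\mathfrak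 g_{t+1})$, put $\theta_t=\theta_{(1)}\circ\dots\circ\theta_{(k)}$. Case 2: $S_\otimes\cap\Delta^{(t)}=\{\xi\}$ and some $\eta\in S_\square\cap\Delta^{(t)}$ satisfies $\eta<\xi$. This occurs only for $n=7$, $t=4$ and two sets $S$: (i) $S=\{\alpha_{14},\alpha_{26},\alpha_{37},\alpha_{47},\alpha_{45}\}$, where $\mathfrak g_5=0$ and $\theta_4:K\to S(\mathfrak g_4)/I_4$ is the unit map; (ii) $S=\{\alpha_{14},\alpha_{25},\alpha_{37},\alpha_{47},\alpha_{46},\alpha_{56}\}$, where $\mathfrak g_5=Ky_{65}$ and $\theta_4(y_{65})=y_{65}-c(\alpha_{47})^{-1}y_{75}y_{64}$. Case 3: $S_\otimes\cap\Delta^{(t)}=\emptyset$; then $\theta_t$ is the map induced by $\mathfrak g_{t+1}\subset\mathfrak g_t$. Put $\mathcal I^{(1)}=I_1$, $\Theta_1=\theta_1:S(\mathfrak g_2)\to S(\mathfrak g)/\mathcal I^{(1)}$. Inductively, given $\Theta_t:S(\mathfrak g_{t+1})\to S(\mathfrak g)/\mathcal I^{(t)}$, let $\mathcal I^{(t+1)}\supset\mathcal I^{(t)}$ be the ideal generated modulo $\mathcal I^{(t)}$ by $\Theta_t(I_{t+1})$, and let $\Theta_{t+1}:S(\mathfrak g_{t+2})\to S(\mathfrak g)/\mathcal I^{(t+1)}$ be $\theta_{t+1}$ followed by the map $S(\mathfrak g_{t+1})/I_{t+1}\to S(\mathfrak g)/\mathcal I^{(t+1)}$ induced by $\Theta_t$.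 Define $\mathcal I_{S,c}=\mathcal I^{(n-1)}$ and $\Omega_{S,c}=\{f\in\mathfrak g^*: a(f)=0\ \forall a\in\mathcal I_{S,c}\}$, which is a coadjoint orbit of $G$. *)

theory Defs
  imports "HOL-Library.Poly_Mapping" "HOL-Library.FuncSet" "HOL-Algebra.QuotRing"
    "Jordan_Normal_Form.Matrix"
begin

section \<open>Roots and admissible subsets\<close>

text \<open>The pair \<open>(j, i)\<close> with \<open>j < i\<close> stands for the root
  \<open>\<alpha>\<^sub>j\<^sub>i = \<epsilon>\<^sub>j - \<epsilon>\<^sub>i\<close>, hence for the matrix unit \<open>y\<^sub>i\<^sub>j\<close> below the diagonal (indices
  swapped). Indices are 1-based.\<close>

type_synonym root = "nat \<times> nat"

definition pos_roots :: "nat \<Rightarrow> root set" where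
  "pos_roots n = {(j, i). 1 \<le> j \<and> j < i \<and> i \<le> n}"

definition root_vec :: "root \<Rightarrow> nat \<Rightarrow> int" where
  "root_vec = (\<lambda>(j, i) k. (if k = j then 1 else 0) - (if k = i then 1 else 0))"

definition root_sum :: "root \<Rightarrow> root \<Rightarrow> root \<Rightarrow> bool" where
  "root_sum \<gamma> \<delta> \<xi> \<longleftrightarrow> (\<forall>k. root_vec \<gamma> k + root_vec \<delta> k = root_vec \<xi> k)"

definition root_diff :: "root \<Rightarrow> root \<Rightarrow> root" where
  "root_diff \<xi> \<gamma> = (THE \<delta>. root_sum \<gamma> \<delta> \<xi>)"

definition root_gt :: "root \<Rightarrow> root \<Rightarrow> bool" where
  "root_gt = (\<lambda>(j, i) (t, s). j < t \<or> (j = t \<and> s < i))"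

definition C_set :: "root \<Rightarrow> root set \<Rightarrow> root set" where
  "C_set \<xi> A = {\<gamma> \<in> A. \<exists>\<delta>\<in>A. root_sum \<gamma> \<delta> \<xi>}"

definition C_plus :: "root \<Rightarrow> root set \<Rightarrow> root set" where
  "C_plus \<xi> A = {\<gamma> \<in> A. \<exists>\<delta>\<in>A. root_sum \<gamma> \<delta> \<xi> \<and> root_gt \<gamma> \<delta>}"

definition enum_desc :: "root set \<Rightarrow> root list" where
  "enum_desc S = (THE xs. sorted_wrt root_gt xs \<and> set xs = S)"

definition nth_root :: "root set \<Rightarrow> nat \<Rightarrow> root" where
  "nth_root S r = enum_desc S ! (r - 1)"

text \<open>\<open>A_seq n S i\<close> is \<open>A\<^sub>i\<close> for \<open>i \<ge> 1\<close>; the value at \<open>0\<close> is never used.\<close>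

fun A_seq :: "nat \<Rightarrow> root set \<Rightarrow> nat \<Rightarrow> root set" where
  "A_seq n S (Suc (Suc i)) =
     A_seq n S (Suc i) - C_set (nth_root S (Suc i)) (A_seq n S (Suc i))"
| "A_seq n S _ = pos_roots n"

definition A_fin :: "nat \<Rightarrow> root set \<Rightarrow> root set" where
  "A_fin n S = A_seq n S (card S + 1)"

definition admissible :: "nat \<Rightarrow> root set \<Rightarrow> bool" where
  "admissible n S \<longleftrightarrow> S \<subseteq> pos_roots n \<and> (\<forall>i\<in>{1..card S}. nth_root S i \<in> A_seq n S i)"

definition S_tens :: "nat \<Rightarrow> root set \<Rightarrow> root set" where
  "S_tens n S = {nth_root S i | i. i \<in> {1..card S} \<and> C_set (nth_root S i) (A_seq n S i) \<noteq> {}}"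

definition S_box :: "nat \<Rightarrow> root set \<Rightarrow> root set" where
  "S_box n S = {nth_root S i | i. i \<in> {1..card S} \<and> C_set (nth_root S i) (A_seq n S i) = {}}"

definition max_admissible :: "nat \<Rightarrow> root set \<Rightarrow> bool" where
  "max_admissible n S \<longleftrightarrow> admissible n S \<and>
     (\<forall>S'. admissible n S' \<and> S_tens n S' = S_tens n S \<and> S_box n S \<subseteq> S_box n S'
        \<longrightarrow> S_box n S' = S_box n S)"

text \<open>The map \<open>c : S \<rightarrow> K\<close> is a total function of which only the values on \<open>S\<close> are ever used
  (see \<open>c_ext\<close>).\<close>

definition max_admissible_pairs :: "nat \<Rightarrow> (root set \<times> (root \<Rightarrow> 'k::zero)) set" where
  "max_admissible_pairs n = {(S, c). max_admissible n S \<and> (\<forall>\<xi>\<in>S_tens n S. c \<xi> \<noteq> 0)}"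

text \<open>The extension of \<open>c\<close> by zero on \<open>M(S) = A(S) - S\<close>.\<close>

definition c_ext :: "root set \<Rightarrow> (root \<Rightarrow> 'k::zero) \<Rightarrow> root \<Rightarrow> 'k" where
  "c_ext S c \<gamma> = (if \<gamma> \<in> S then c \<gamma> else 0)"

section \<open>The Lie algebra of strictly lower triangular matrices and its dual\<close>

definition ut :: "nat \<Rightarrow> 'k::field_char_0 mat set" where
  "ut n = {x \<in> carrier_mat n n. \<forall>i<n. \<forall>j<n. i \<le> j \<longrightarrow> x $$ (i, j) = 0}"

definition y_unit :: "nat \<Rightarrow> root \<Rightarrow> 'k::field_char_0 mat" where
  "y_unit n = (\<lambda>(j, i). mat n n (\<lambda>(r, s). if r = i - 1 \<and> s = j - 1 then 1 else 0))"

definition coord :: "'k::field_char_0 mat \<Rightarrow> root \<Rightarrow> 'k" where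
  "coord x = (\<lambda>(j, i). x $$ (i - 1, j - 1))"

definition lie :: "'k::field_char_0 mat \<Rightarrow> 'k mat \<Rightarrow> 'k mat" where
  "lie x y = x * y - y * x"

definition ut_dual :: "nat \<Rightarrow> ('k::field_char_0 mat \<Rightarrow> 'k) set" where
  "ut_dual n = {f \<in> extensional (ut n).
     (\<forall>x\<in>ut n. \<forall>y\<in>ut n. f (x + y) = f x + f y) \<and>
     (\<forall>r. \<forall>x\<in>ut n. f (r \<cdot>\<^sub>m x) = r * f x)}"

definition canonical_form ::
  "nat \<Rightarrow> root set \<Rightarrow> (root \<Rightarrow> 'k) \<Rightarrow> 'k::field_char_0 mat \<Rightarrow> 'k" where
  "canonical_form n S c = (\<lambda>x\<in>ut n. \<Sum>\<gamma>\<in>pos_roots n.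
     (if \<gamma> \<in> A_fin n S then c_ext S c \<gamma> else 0) * coord x \<gamma>)"

lemma finite_pos_roots: "finite (pos_roots n)"
  by (rule finite_subset[of _ "{0..n} \<times> {0..n}"]) (auto simp: pos_roots_def)

lemma canonical_form_y_unit:
  assumes "\<gamma> \<in> pos_roots n"
  shows "canonical_form n S c (y_unit n \<gamma>) = (if \<gamma> \<in> A_fin n S then c_ext S c \<gamma> else 0)"
proof -
  have ut: "y_unit n \<gamma> \<in> ut n"
    using assms by (auto simp: y_unit_def ut_def pos_roots_def)
  have coord: "coord (y_unit n \<gamma>) \<delta> = (if \<delta> = \<gamma> then 1 else 0)" if "\<delta> \<in> pos_roots n" for \<delta>
    using assms that by (auto simp: coord_def y_unit_def pos_roots_def split: if_splits)
  have "canonical_form n S c (y_unit n \<gamma>) = (\<Sum>\<delta>\<in>pos_roots n.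
      if \<delta> = \<gamma> then (if \<gamma> \<in> A_fin n S then c_ext S c \<gamma> else 0) else 0)"
    unfolding canonical_form_def restrict_apply'[OF ut] by (intro sum.cong refl) (simp add: coord)
  thus ?thesis using assms by (simp add: finite_pos_roots)
qed

section \<open>Symmetric algebras and the Poisson bracket\<close>

text \<open>Polynomials over \<open>K\<close> in commuting variables \<open>y\<^sub>\<gamma>\<close>, as finitely supported functions on
  monomials, a monomial being a finitely supported exponent function.\<close>

type_synonym 'k mpoly = "(root \<Rightarrow>\<^sub>0 nat) \<Rightarrow>\<^sub>0 'k"

definition Const :: "'k::field_char_0 \<Rightarrow> 'k mpoly" where
  "Const r = Poly_Mapping.single 0 r"

definition Y :: "root \<Rightarrow> 'k::field_char_0 mpoly" where
  "Y \<gamma> = Poly_Mapping.single (Poly_Mapping.single \<gamma> 1) 1"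

text \<open>The symmetric algebra of the span of the \<open>y\<^sub>\<gamma>\<close>, \<open>\<gamma> \<in> B\<close>.\<close>

definition sym_alg :: "root set \<Rightarrow> 'k::field_char_0 mpoly ring" where
  "sym_alg B = \<lparr>carrier = {p. \<forall>m\<in>Poly_Mapping.keys p. Poly_Mapping.keys m \<subseteq> B},
     monoid.mult = (*), one = 1, zero = 0, add = (+)\<rparr>"

definition subst_poly :: "('k \<Rightarrow> 'a) \<Rightarrow> (root \<Rightarrow> 'a) \<Rightarrow> 'k::field_char_0 mpoly \<Rightarrow> 'a::comm_ring_1"
  where
  "subst_poly h v p = (\<Sum>m\<in>Poly_Mapping.keys p. h (Poly_Mapping.lookup p m) *
     (\<Prod>\<gamma>\<in>Poly_Mapping.keys m. v \<gamma> ^ Poly_Mapping.lookup m \<gamma>))"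

text \<open>The value \<open>a(f)\<close> of a polynomial function \<open>a\<close> at a linear form \<open>f\<close>.\<close>

definition eval_at :: "nat \<Rightarrow> 'k::field_char_0 mpoly \<Rightarrow> ('k mat \<Rightarrow> 'k) \<Rightarrow> 'k" where
  "eval_at n a f = subst_poly (\<lambda>r. r) (\<lambda>\<gamma>. f (y_unit n \<gamma>)) a"

definition partial_deriv :: "root \<Rightarrow> 'k::field_char_0 mpoly \<Rightarrow> 'k mpoly" where
  "partial_deriv \<gamma> p = (\<Sum>m\<in>Poly_Mapping.keys p.
     Poly_Mapping.single (m - Poly_Mapping.single \<gamma> 1)
       (of_nat (Poly_Mapping.lookup m \<gamma>) * Poly_Mapping.lookup p m))"

text \<open>The inclusion of the Lie algebra into its symmetric algebra.\<close>

definition lin_poly :: "nat \<Rightarrow> 'k::field_char_0 mat \<Rightarrow> 'k mpoly" where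
  "lin_poly n x = (\<Sum>\<gamma>\<in>pos_roots n. Const (coord x \<gamma>) * Y \<gamma>)"

text \<open>The biderivation of \<open>S(\<gg>)\<close> that extends the Lie bracket, written in coordinates.\<close>

definition poisson :: "nat \<Rightarrow> 'k::field_char_0 mpoly \<Rightarrow> 'k mpoly \<Rightarrow> 'k mpoly" where
  "poisson n a b = (\<Sum>\<gamma>\<in>pos_roots n. \<Sum>\<delta>\<in>pos_roots n.
     partial_deriv \<gamma> a * partial_deriv \<delta> b * lin_poly n (lie (y_unit n \<gamma>) (y_unit n \<delta>)))"

lemma poisson_Y:
  assumes "\<gamma> \<in> pos_roots n" "\<delta> \<in> pos_roots n"
  shows "poisson n (Y \<gamma>) (Y \<delta>) = lin_poly n (lie (y_unit n \<gamma>) (y_unit n \<delta>))"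
proof -
  have pd: "partial_deriv \<alpha> (Y \<beta>) = (if \<alpha> = \<beta> then 1 else 0)" for \<alpha> \<beta>
    by (auto simp: partial_deriv_def Y_def lookup_single when_def)
  have "poisson n (Y \<gamma>) (Y \<delta>) = (\<Sum>\<gamma>'\<in>pos_roots n. if \<gamma>' = \<gamma> then
     (\<Sum>\<delta>'\<in>pos_roots n. if \<delta>' = \<delta> then lin_poly n (lie (y_unit n \<gamma>) (y_unit n \<delta>)) else 0) else 0)"
    unfolding poisson_def pd by (intro sum.cong refl) (auto intro!: sum.cong)
  thus ?thesis using assms by (simp add: finite_pos_roots)
qed

section \<open>The algebras \<open>S(\<gg>\<^sub>t) / I\<^sub>t\<close> and the maps \<open>\<theta>\<^sub>t\<close>\<close>

definition row :: "nat \<Rightarrow> nat \<Rightarrow> root set" where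
  "row n t = {(j, i) \<in> pos_roots n. j = t}"

definition m_idx :: "nat \<Rightarrow> root set \<Rightarrow> nat \<Rightarrow> nat" where
  "m_idx n S t = 1 + Max ({0} \<union> {r \<in> {1..card S}. nth_root S r \<in> (\<Union>u\<in>{1..<t}. row n u)})"

definition B_set :: "nat \<Rightarrow> root set \<Rightarrow> nat \<Rightarrow> root set" where
  "B_set n S t = A_seq n S (m_idx n S t) \<inter> {(j, i). t \<le> j \<and> j < i \<and> i \<le> n}"

definition row_gens :: "nat \<Rightarrow> root set \<Rightarrow> (root \<Rightarrow> 'k) \<Rightarrow> nat \<Rightarrow> 'k::field_char_0 mpoly set" where
  "row_gens n S c t = {Y \<gamma> - Const (c_ext S c \<gamma>) | \<gamma>. \<gamma> \<in> A_fin n S \<inter> row n t}"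

definition I_ideal :: "nat \<Rightarrow> root set \<Rightarrow> (root \<Rightarrow> 'k) \<Rightarrow> nat \<Rightarrow> 'k::field_char_0 mpoly set" where
  "I_ideal n S c t = Idl\<^bsub>sym_alg (B_set n S t)\<^esub> (row_gens n S c t)"

text \<open>Elements of quotient rings are cosets, and a map on a quotient induced by a map \<open>h\<close> on
  representatives sends the coset \<open>X\<close> to \<open>\<Union>a\<in>X. h a\<close>, with \<open>h a\<close> a coset of the target ideal
  (a union of equal cosets, as \<open>h\<close> descends).\<close>

text \<open>The data of Case 1, for the root \<open>\<xi>\<close> with \<open>S\<^sub>\<otimes> \<inter> \<Delta>\<^sup>(\<^sup>t\<^sup>) = {\<xi>}\<close>:
  \<open>\<gamma>\<^sub>i\<close>, \<open>\<gamma>\<^sub>i'\<close>, the basis of \<open>\<gg>\<^sub>t\<^sup>(\<^sup>m\<^sup>)\<close>, the ideal \<open>I\<^sub>t\<^sup>(\<^sup>m\<^sup>)\<close> and \<open>\<theta>\<^sub>(\<^sub>m\<^sub>)\<close>.\<close>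

definition gam :: "nat \<Rightarrow> root set \<Rightarrow> nat \<Rightarrow> root \<Rightarrow> nat \<Rightarrow> root" where
  "gam n S t \<xi> i = nth_root (C_plus \<xi> (B_set n S t)) i"

definition gam' :: "nat \<Rightarrow> root set \<Rightarrow> nat \<Rightarrow> root \<Rightarrow> nat \<Rightarrow> root" where
  "gam' n S t \<xi> i = root_diff \<xi> (gam n S t \<xi> i)"

definition B_step :: "nat \<Rightarrow> root set \<Rightarrow> nat \<Rightarrow> root \<Rightarrow> nat \<Rightarrow> root set" where
  "B_step n S t \<xi> m = B_set n S t - gam' n S t \<xi> ` {1..m}"

definition I_step ::
  "nat \<Rightarrow> root set \<Rightarrow> (root \<Rightarrow> 'k) \<Rightarrow> nat \<Rightarrow> root \<Rightarrow> nat \<Rightarrow> 'k::field_char_0 mpoly set" where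
  "I_step n S c t \<xi> m = Idl\<^bsub>sym_alg (B_step n S t \<xi> m)\<^esub>
     (row_gens n S c t \<union> (\<lambda>i. Y (gam n S t \<xi> i)) ` {1..m})"

text \<open>The sum over all \<open>s \<ge> 0\<close> below has finitely many nonzero terms, \<open>ad\<^sub>p\<close> being locally
  nilpotent.\<close>

definition exp_ad ::
  "nat \<Rightarrow> 'k::field_char_0 mpoly \<Rightarrow> 'k mpoly \<Rightarrow> 'k mpoly \<Rightarrow> 'k mpoly" where
  "exp_ad n p q a =
     Sum_any (\<lambda>s::nat. Const ((-1) ^ s / fact s) * (poisson n p ^^ s) a * q ^ s)"

definition theta_step ::
  "nat \<Rightarrow> root set \<Rightarrow> (root \<Rightarrow> 'k) \<Rightarrow> nat \<Rightarrow> root \<Rightarrow> nat \<Rightarrow>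
     'k::field_char_0 mpoly set \<Rightarrow> 'k mpoly set" where
  "theta_step n S c t \<xi> m X = (\<Union>a\<in>X.
     I_step n S c t \<xi> (m - 1) +>\<^bsub>sym_alg (B_step n S t \<xi> (m - 1))\<^esub>
       exp_ad n (Y (gam' n S t \<xi> m)) (Const (inverse (c \<xi>)) * Y (gam n S t \<xi> m)) a)"

text \<open>\<open>theta_comp n S c t \<xi> m\<close> is \<open>\<theta>\<^sub>(\<^sub>1\<^sub>) \<circ> \<dots> \<circ> \<theta>\<^sub>(\<^sub>m\<^sub>)\<close>.\<close>

primrec theta_comp ::
  "nat \<Rightarrow> root set \<Rightarrow> (root \<Rightarrow> 'k) \<Rightarrow> nat \<Rightarrow> root \<Rightarrow> nat \<Rightarrow>
     'k::field_char_0 mpoly set \<Rightarrow> 'k mpoly set" where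
  "theta_comp n S c t \<xi> 0 = id"
| "theta_comp n S c t \<xi> (Suc m) = theta_comp n S c t \<xi> m \<circ> theta_step n S c t \<xi> (Suc m)"

text \<open>\<open>a \<in> S(\<gg>\<^sub>t\<^sub>+\<^sub>1)\<close> is identified with its coset in \<open>S(\<gg>\<^sub>t\<^sup>(\<^sup>k\<^sup>)) / I\<^sub>t\<^sup>(\<^sup>k\<^sup>)\<close>.\<close>

definition theta_case1 ::
  "nat \<Rightarrow> root set \<Rightarrow> (root \<Rightarrow> 'k) \<Rightarrow> nat \<Rightarrow> root \<Rightarrow> 'k::field_char_0 mpoly \<Rightarrow> 'k mpoly set" where
  "theta_case1 n S c t \<xi> a =
     (let k = card (C_plus \<xi> (B_set n S t)) in
      theta_comp n S c t \<xi> k (I_step n S c t \<xi> k +>\<^bsub>sym_alg (B_step n S t \<xi> k)\<^esub> a))"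

text \<open>Case 2 (ii): the substitution \<open>y\<^sub>6\<^sub>5 \<mapsto> y\<^sub>6\<^sub>5 - c(\<alpha>\<^sub>4\<^sub>7)\<^sup>-\<^sup>1 y\<^sub>7\<^sub>5 y\<^sub>6\<^sub>4\<close> on
  \<open>S(\<gg>\<^sub>5) = K[y\<^sub>6\<^sub>5]\<close>.\<close>

definition S_ii :: "root set" where
  "S_ii = {(1, 4), (2, 5), (3, 7), (4, 7), (4, 6), (5, 6)}"

definition case2ii_subst :: "(root \<Rightarrow> 'k) \<Rightarrow> 'k::field_char_0 mpoly \<Rightarrow> 'k mpoly" where
  "case2ii_subst c = subst_poly Const
     (\<lambda>\<gamma>. if \<gamma> = (5, 6) then Y (5, 6) - Const (inverse (c (4, 7))) * Y (5, 7) * Y (4, 6) else Y \<gamma>)"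

text \<open>\<open>theta n S c t : S(\<gg>\<^sub>t\<^sub>+\<^sub>1) \<rightarrow> S(\<gg>\<^sub>t) / I\<^sub>t\<close>, for \<open>n \<le> 7\<close>. The last branch is Case 3 together with
  Case 2 (i), where \<open>S(\<gg>\<^sub>5) = K\<close> and the map induced by the inclusion is the unit map; for a maximal
  admissible pair with \<open>n \<le> 7\<close> no other situation reaches it.\<close>

definition theta ::
  "nat \<Rightarrow> root set \<Rightarrow> (root \<Rightarrow> 'k) \<Rightarrow> nat \<Rightarrow> 'k::field_char_0 mpoly \<Rightarrow> 'k mpoly set" where
  "theta n S c t a =
    (if \<exists>\<xi>. S_tens n S \<inter> row n t = {\<xi>} \<and> (\<forall>\<eta>\<in>S_box n S \<inter> row n t. root_gt \<eta> \<xi>)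
     then theta_case1 n S c t (the_elem (S_tens n S \<inter> row n t)) a
     else if n = 7 \<and> t = 4 \<and> S = S_ii
     then I_ideal n S c t +>\<^bsub>sym_alg (B_set n S t)\<^esub> case2ii_subst c a
     else I_ideal n S c t +>\<^bsub>sym_alg (B_set n S t)\<^esub> a)"

section \<open>The ideal and the orbit attached to a pair\<close>

text \<open>\<open>calI_Theta n S c t\<close> is the pair of the ideal \<open>\<I>\<^sup>(\<^sup>t\<^sup>+\<^sup>1\<^sup>)\<close> and the map
  \<open>\<Theta>\<^sub>t\<^sub>+\<^sub>1 : S(\<gg>\<^sub>t\<^sub>+\<^sub>2) \<rightarrow> S(\<gg>) / \<I>\<^sup>(\<^sup>t\<^sup>+\<^sup>1\<^sup>)\<close>. An ideal generated modulo \<open>\<I>\<close> by a set of cosets is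
  generated by \<open>\<I>\<close> and the elements of these cosets.\<close>

primrec calI_Theta ::
  "nat \<Rightarrow> root set \<Rightarrow> (root \<Rightarrow> 'k) \<Rightarrow> nat \<Rightarrow>
     'k::field_char_0 mpoly set \<times> ('k mpoly \<Rightarrow> 'k mpoly set)" where
  "calI_Theta n S c 0 = (I_ideal n S c 1, theta n S c 1)"
| "calI_Theta n S c (Suc t) =
    (let \<I> = fst (calI_Theta n S c t); \<Theta> = snd (calI_Theta n S c t);
         \<I>' = Idl\<^bsub>sym_alg (pos_roots n)\<^esub> (\<I> \<union> \<Union> (\<Theta> ` I_ideal n S c (t + 2)))
     in (\<I>', \<lambda>a. \<Union>b\<in>theta n S c (t + 2) a. \<Union>d\<in>\<Theta> b. \<I>' +>\<^bsub>sym_alg (pos_roots n)\<^esub> d))"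

definition calI :: "nat \<Rightarrow> root set \<Rightarrow> (root \<Rightarrow> 'k) \<Rightarrow> 'k::field_char_0 mpoly set" where
  "calI n S c = fst (calI_Theta n S c (n - 2))"

definition Omega :: "nat \<Rightarrow> root set \<Rightarrow> (root \<Rightarrow> 'k) \<Rightarrow> ('k::field_char_0 mat \<Rightarrow> 'k) set" where
  "Omega n S c = {f \<in> ut_dual n. \<forall>a\<in>calI n S c. eval_at n a f = 0}"

end

theory Submission
  imports Defs
begin

text \<open>Evaluation at the canonical form \<open>f\<close> is unchanged by every \<open>\<theta>\<^sub>t\<close>, so \<open>f\<close> annihilates the generators
  of \<open>\<I>\<^sub>S\<^sub>,\<^sub>c\<close> as soon as it annihilates those of all \<open>I\<^sub>t\<close>, which it does by construction. In Case 1
  each \<open>\<gamma>\<^sub>m \<in> C\<^sub>+(\<xi>, B\<^sub>t)\<close> is removed when passing from \<open>A\<^sub>i\<close> to \<open>A\<^sub>i\<^sub>+\<^sub>1\<close> with \<open>\<xi> = \<xi>\<^sub>i\<close>, whence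
  \<open>f(y\<^bsub>\<gamma>\<^sub>m\<^esub>) = 0\<close>: the element \<open>q\<close> evaluates to zero and only the term \<open>s = 0\<close> of the exponential
  series survives. In Case 2 (ii) the correction term contains \<open>y\<^sub>7\<^sub>5\<close>, on which \<open>f\<close> vanishes because
  \<open>\<alpha>\<^sub>5\<^sub>7 \<notin> S\<close>.\<close>

section \<open>Evaluation of polynomials\<close>

definition mon_val :: "(root \<Rightarrow> 'a) \<Rightarrow> (root \<Rightarrow>\<^sub>0 nat) \<Rightarrow> 'a::comm_ring_1" where
  "mon_val v m = (\<Prod>\<gamma>\<in>Poly_Mapping.keys m. v \<gamma> ^ Poly_Mapping.lookup m \<gamma>)"

text \<open>The extra factors are \<open>v \<gamma> ^ 0\<close>, so two monomials can be compared
  over a common index set.\<close>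

lemma mon_val_superset:
  assumes "finite A" "Poly_Mapping.keys m \<subseteq> A"
  shows "mon_val v m = (\<Prod>\<gamma>\<in>A. v \<gamma> ^ Poly_Mapping.lookup m \<gamma>)"
  unfolding mon_val_def using assms
  by (intro prod.mono_neutral_left) (auto simp: in_keys_iff)

lemma mon_val_add: "mon_val v (m + m') = mon_val v m * mon_val v m'"
proof -
  let ?A = "Poly_Mapping.keys m \<union> Poly_Mapping.keys m'"
  have "mon_val v (m + m') = (\<Prod>\<gamma>\<in>?A. v \<gamma> ^ Poly_Mapping.lookup (m + m') \<gamma>)"
    by (rule mon_val_superset) (simp_all add: keys_add)
  also have "\<dots> = mon_val v m * mon_val v m'"
    by (subst (1 2) mon_val_superset[of ?A])
      (auto simp: lookup_add power_add prod.distrib)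
  finally show ?thesis .
qed

abbreviation ev :: "(root \<Rightarrow> 'k) \<Rightarrow> 'k::field_char_0 mpoly \<Rightarrow> 'k" where
  "ev \<equiv> subst_poly (\<lambda>r. r)"

lemma ev_alt:
  "ev v p = (\<Sum>m\<in>Poly_Mapping.keys p. Poly_Mapping.lookup p m * mon_val v m)"
  by (simp add: subst_poly_def mon_val_def)

lemma ev_0 [simp]: "ev v 0 = 0"
  by (simp add: ev_alt)

lemma ev_add [simp]: "ev v (p + q) = ev v p + ev v q"
  unfolding ev_alt by (rule setsum_keys_plus_distrib) (auto simp: algebra_simps)

lemma ev_sum [simp]: "ev v (sum f A) = (\<Sum>a\<in>A. ev v (f a))"
  by (induction A rule: infinite_finite_induct) auto

lemma ev_single: "ev v (Poly_Mapping.single m r) = r * mon_val v m"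
  by (simp add: ev_alt)

lemma poly_mapping_sum_single:
  "p = (\<Sum>m\<in>Poly_Mapping.keys p. Poly_Mapping.single m (Poly_Mapping.lookup p m))"
  by (rule poly_mapping_eqI) (auto simp: lookup_sum lookup_single when_def in_keys_iff)

text \<open>Expanding both factors into monomials reduces this to
  \<open>mon_val_add\<close>.\<close>

lemma ev_mult [simp]: "ev v (p * q) = ev v p * ev v q"
proof -
  let ?s = "\<lambda>p m. Poly_Mapping.single m (Poly_Mapping.lookup p m)"
  have "p * q = (\<Sum>m\<in>Poly_Mapping.keys p. \<Sum>m'\<in>Poly_Mapping.keys q. ?s p m * ?s q m')"
    by (subst poly_mapping_sum_single[of p], subst poly_mapping_sum_single[of q])
      (rule sum_product)
  then show ?thesis
    by (simp add: mult_single ev_single mon_val_add ev_alt[of v p] ev_alt[of v q] sum_product mult_ac)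
qed

lemma ev_1 [simp]: "ev v 1 = 1"
  by (simp add: ev_single mon_val_def flip: single_one)

lemma ev_prod [simp]: "ev v (prod f A) = (\<Prod>a\<in>A. ev v (f a))"
  by (induction A rule: infinite_finite_induct) auto

lemma ev_power [simp]: "ev v (p ^ k) = ev v p ^ k"
  by (induction k) auto

lemma ev_Const [simp]: "ev v (Const r) = r"
  by (simp add: Const_def ev_single mon_val_def)

lemma ev_Y [simp]: "ev v (Y \<gamma>) = v \<gamma>"
  by (simp add: Y_def ev_single mon_val_def)

lemma ev_uminus [simp]: "ev v (- p) = - ev v p"
  using ev_add[of v p "- p"] by (simp add: eq_neg_iff_add_eq_0 add.commute del: ev_add)

lemma ev_diff [simp]: "ev v (p - q) = ev v p - ev v q"
  using ev_add[of v p "- q"] by simp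

lemma ev_subst_poly: "ev v (subst_poly Const w p) = ev (\<lambda>\<gamma>. ev v (w \<gamma>)) p"
  unfolding subst_poly_def[of Const] by (simp add: ev_alt[of _ p] mon_val_def)

section \<open>The polynomial algebras\<close>

abbreviation pol :: "root set \<Rightarrow> 'k::field_char_0 mpoly set" where
  "pol B \<equiv> carrier (sym_alg B)"

lemma pol_iff: "p \<in> pol B \<longleftrightarrow> (\<forall>m\<in>Poly_Mapping.keys p. Poly_Mapping.keys m \<subseteq> B)"
  by (simp add: sym_alg_def)

lemma pol_mono: "B \<subseteq> B' \<Longrightarrow> pol B \<subseteq> pol B'"
  unfolding subset_iff[of "pol B"] pol_iff by blast

lemma pol_0 [simp]: "0 \<in> pol B"
  by (simp add: pol_iff)

lemma pol_Const [simp]: "Const r \<in> pol B"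
  by (simp add: pol_iff Const_def)

lemma pol_1 [simp]: "1 \<in> pol B"
  by (simp add: pol_iff flip: single_one)

lemma pol_Y [simp]: "Y \<gamma> \<in> pol B \<longleftrightarrow> \<gamma> \<in> B"
  by (simp add: pol_iff Y_def)

lemma pol_add [intro]: "p \<in> pol B \<Longrightarrow> q \<in> pol B \<Longrightarrow> p + q \<in> pol B"
  unfolding pol_iff using keys_add[of p q] by blast

lemma pol_uminus [intro]: "p \<in> pol B \<Longrightarrow> - p \<in> pol B"
  by (auto simp: pol_iff)

lemma pol_diff [intro]: "p \<in> pol B \<Longrightarrow> q \<in> pol B \<Longrightarrow> p - q \<in> pol B"
  unfolding pol_iff using keys_diff[of p q] by blast

lemma pol_mult [intro]:
  assumes "p \<in> pol B" "q \<in> pol B"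
  shows "p * q \<in> pol B"
  unfolding pol_iff
proof
  fix m assume "m \<in> Poly_Mapping.keys (p * q)"
  then obtain a b where "m = a + b" "a \<in> Poly_Mapping.keys p" "b \<in> Poly_Mapping.keys q"
    using keys_mult by blast
  then show "Poly_Mapping.keys m \<subseteq> B"
    using assms keys_add[of a b] unfolding pol_iff by blast
qed

lemma pol_power [intro]: "p \<in> pol B \<Longrightarrow> p ^ k \<in> pol B"
  by (induction k) auto

lemma pol_sum [intro]: "(\<And>a. a \<in> A \<Longrightarrow> f a \<in> pol B) \<Longrightarrow> sum f A \<in> pol B"
  by (induction A rule: infinite_finite_induct) auto

lemma pol_prod [intro]: "(\<And>a. a \<in> A \<Longrightarrow> f a \<in> pol B) \<Longrightarrow> prod f A \<in> pol B"
  by (induction A rule: infinite_finite_induct) auto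

lemma pol_subst_poly:
  assumes "p \<in> pol B" "\<And>\<gamma>. \<gamma> \<in> B \<Longrightarrow> w \<gamma> \<in> pol B'"
  shows "subst_poly Const w p \<in> pol B'"
  unfolding subst_poly_def
proof (intro pol_sum pol_mult pol_Const pol_prod pol_power assms(2))
  show "\<gamma> \<in> B" if "m \<in> Poly_Mapping.keys p" "\<gamma> \<in> Poly_Mapping.keys m" for m \<gamma>
    using assms(1) that unfolding pol_iff by blast
qed

lemma sym_alg_simps:
  "monoid.mult (sym_alg B) = (*)" "one (sym_alg B) = 1" "zero (sym_alg B) = 0"
  "add (sym_alg B) = (+)"
  by (simp_all add: sym_alg_def)

lemma ring_sym_alg: "ring (sym_alg B)"
proof (rule ringI)
  show "abelian_group (sym_alg B)"
  proof (rule abelian_groupI)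
    fix x assume "x \<in> pol B"
    then show "\<exists>y\<in>pol B. y \<oplus>\<^bsub>sym_alg B\<^esub> x = \<zero>\<^bsub>sym_alg B\<^esub>"
      by (intro bexI[of _ "- x"]) (auto simp: sym_alg_simps)
  qed (auto simp: sym_alg_simps algebra_simps)
  show "monoid (sym_alg B)"
    by (rule monoidI) (auto simp: sym_alg_simps algebra_simps)
qed (auto simp: sym_alg_simps algebra_simps)

text \<open>For \<open>r = 0\<close> this is the kernel of evaluation at \<open>v\<close>, otherwise
  a coset of it. Maps into quotients have cosets as values, so invariance of evaluation is expressed
  by sending elements of a fiber to subsets of the fiber with the same \<open>r\<close>.\<close>

abbreviation fiber :: "root set \<Rightarrow> (root \<Rightarrow> 'k) \<Rightarrow> 'k \<Rightarrow> 'k::field_char_0 mpoly set" where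
  "fiber B v r \<equiv> {p \<in> pol B. ev v p = r}"

lemma ideal_fiber_0: "ideal (fiber B v 0) (sym_alg B)"
proof (rule idealI[OF ring_sym_alg])
  interpret ring "sym_alg B" by (rule ring_sym_alg)
  show "subgroup (fiber B v 0) (add_monoid (sym_alg B))"
  proof (rule add.subgroupI)
    fix a assume a: "a \<in> fiber B v 0"
    have "\<ominus>\<^bsub>sym_alg B\<^esub> a = - a"
      by (rule minus_equality) (use a in \<open>auto simp: sym_alg_simps\<close>)
    then show "\<ominus>\<^bsub>sym_alg B\<^esub> a \<in> fiber B v 0"
      using a by auto
  next
    have "0 \<in> fiber B v 0" by simp
    then show "fiber B v 0 \<noteq> {}" by blast
  qed (auto simp: sym_alg_simps)
qed (auto simp: sym_alg_simps)

text \<open>The hypothesis that \<open>H\<close> lies in the carrier matters: no ideal contains a larger set, and then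
  \<open>genideal\<close> is the empty intersection \<open>UNIV\<close>.\<close>

lemma Idl_subset_fiber_0:
  assumes "H \<subseteq> fiber B v 0"
  shows "Idl\<^bsub>sym_alg B\<^esub> H \<subseteq> fiber B v 0"
  using ring.genideal_minimal[OF ring_sym_alg ideal_fiber_0 assms] .

text \<open>All algebras \<open>sym_alg B'\<close> share the addition of polynomials, so a coset
  formed in a small one can be treated in the largest one.\<close>

lemma coset_subset_fiber:
  assumes "I \<subseteq> fiber B v 0" "p \<in> fiber B v r"
  shows "I +>\<^bsub>sym_alg B'\<^esub> p \<subseteq> fiber B v r"
  using assms by (auto simp: a_r_coset_def' sym_alg_simps)

section \<open>Local nilpotency of the Poisson action of a matrix unit\<close>

text \<open>\<open>ad\<^sub>p\<close> for \<open>p = y\<^sub>\<gamma>\<close> keeps the degree of a monomial and raises its total height, which is bounded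
  in terms of the degree. Without local nilpotency \<open>Sum_any\<close> in \<open>exp_ad\<close> would be the junk value 0.\<close>

definition mon_deg :: "nat \<Rightarrow> (root \<Rightarrow>\<^sub>0 nat) \<Rightarrow> nat" where
  "mon_deg n m = (\<Sum>\<gamma>\<in>pos_roots n. Poly_Mapping.lookup m \<gamma>)"

definition mon_height :: "nat \<Rightarrow> (root \<Rightarrow>\<^sub>0 nat) \<Rightarrow> nat" where
  "mon_height n m = (\<Sum>\<gamma>\<in>pos_roots n. Poly_Mapping.lookup m \<gamma> * (snd \<gamma> - fst \<gamma>))"

text \<open>A filtration rather than a grading: with degree bounded above and height bounded below,
  inhomogeneous polynomials belong to it as well.\<close>

definition graded :: "nat \<Rightarrow> nat \<Rightarrow> nat \<Rightarrow> 'k::field_char_0 mpoly set" where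
  "graded n d h = {p \<in> pol (pos_roots n).
     \<forall>m\<in>Poly_Mapping.keys p. mon_deg n m \<le> d \<and> h \<le> mon_height n m}"

lemma mon_height_le: "mon_height n m \<le> n * mon_deg n m"
  unfolding mon_height_def mon_deg_def sum_distrib_left
  by (rule sum_mono) (auto simp: pos_roots_def mult.commute)

lemma graded_eq_0:
  assumes "p \<in> graded n d h" "n * d < h"
  shows "p = 0"
proof -
  have "Poly_Mapping.keys p = {}"
  proof (rule ccontr)
    assume "Poly_Mapping.keys p \<noteq> {}"
    then obtain m where "m \<in> Poly_Mapping.keys p" by blast
    then have m: "mon_deg n m \<le> d" "h \<le> mon_height n m" using assms by (auto simp: graded_def)
    have "mon_height n m \<le> n * d"
      using mon_height_le[of n m] mult_le_mono2[OF m(1), of n] by linarith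
    then show False using m assms by linarith
  qed
  then show ?thesis by simp
qed

text \<open>A commutator of matrix units is zero or, up to sign, the matrix unit of the sum of the
  two roots, and heights add.\<close>

lemma lie_y_unit_coord:
  assumes "\<gamma> \<in> pos_roots n" "\<delta> \<in> pos_roots n" "\<beta> \<in> pos_roots n"
    and "coord (lie (y_unit n \<gamma>) (y_unit n \<delta>)) \<beta> \<noteq> (0::'k::field_char_0)"
  shows "snd \<beta> - fst \<beta> = (snd \<gamma> - fst \<gamma>) + (snd \<delta> - fst \<delta>)"
proof -
  obtain j i t s a b where eq: "\<gamma> = (j, i)" "\<delta> = (t, s)" "\<beta> = (a, b)"
    by (metis surj_pair)
  have prod: "(y_unit n (j, i) * y_unit n (t, s) :: 'k mat) $$ (b - 1, a - 1) =
      (if b = i \<and> j = s \<and> a = t then 1 else 0)"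
    if "(j, i) \<in> pos_roots n" "(t, s) \<in> pos_roots n" "(a, b) \<in> pos_roots n" for j i t s
  proof -
    \<comment> \<open>Indices of positive roots are at least 1, so the truncated shift to 0-based
      matrix indices is injective.\<close>
    have idx: "b - 1 = i - 1 \<longleftrightarrow> b = i" "j - 1 = s - 1 \<longleftrightarrow> j = s" "a - 1 = t - 1 \<longleftrightarrow> a = t"
      using that by (auto simp: pos_roots_def)
    have "(y_unit n (j, i) * y_unit n (t, s) :: 'k mat) $$ (b - 1, a - 1) =
      (\<Sum>k\<in>{0..<n}. (if b - 1 = i - 1 \<and> k = j - 1 then 1 else 0) *
        (if k = s - 1 \<and> a - 1 = t - 1 then 1 else 0))"
      using that by (auto simp: y_unit_def scalar_prod_def pos_roots_def)
    also have "\<dots> = (\<Sum>k\<in>{0..<n}.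
        if k = j - 1 then (if b = i \<and> j = s \<and> a = t then 1 else 0) else 0)"
      by (intro sum.cong refl) (use idx in \<open>auto simp del: One_nat_def\<close>)
    finally show ?thesis using that by (auto simp: pos_roots_def)
  qed
  have "coord (lie (y_unit n \<gamma>) (y_unit n \<delta>) :: 'k mat) \<beta> =
      (y_unit n (j, i) * y_unit n (t, s) :: 'k mat) $$ (b - 1, a - 1) -
      (y_unit n (t, s) * y_unit n (j, i) :: 'k mat) $$ (b - 1, a - 1)"
    using assms(1-3) by (auto simp: eq coord_def lie_def y_unit_def pos_roots_def)
  then have "b = i \<and> j = s \<and> a = t \<or> b = s \<and> t = i \<and> a = j"
    using assms prod[of j i t s] prod[of t s j i] by (auto simp: eq split: if_splits)
  then show ?thesis using assms(1-3) by (auto simp: eq pos_roots_def)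
qed

lemma keys_lin_poly:
  assumes "m \<in> Poly_Mapping.keys (lin_poly n x)"
  shows "\<exists>\<beta>\<in>pos_roots n. coord x \<beta> \<noteq> 0 \<and> m = Poly_Mapping.single \<beta> 1"
proof -
  obtain \<beta> where "\<beta> \<in> pos_roots n" "m \<in> Poly_Mapping.keys (Const (coord x \<beta>) * Y \<beta>)"
    using subsetD[OF keys_sum assms[unfolded lin_poly_def]] by (rule UN_E)
  then show ?thesis
    by (auto simp: Const_def Y_def mult_single split: if_splits)
qed

text \<open>Monomials without \<delta> get coefficient 0, so on the surviving ones the truncated
  subtraction in \<open>partial_deriv\<close> is a genuine one.\<close>

lemma keys_partial_deriv:
  assumes "m \<in> Poly_Mapping.keys (partial_deriv \<delta> p)"
  shows "\<exists>m'\<in>Poly_Mapping.keys p. m' = m + Poly_Mapping.single \<delta> 1"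
proof -
  obtain m' where m': "m' \<in> Poly_Mapping.keys p" "m \<in> Poly_Mapping.keys (Poly_Mapping.single
      (m' - Poly_Mapping.single \<delta> 1)
      (of_nat (Poly_Mapping.lookup m' \<delta>) * Poly_Mapping.lookup p m'))"
    using subsetD[OF keys_sum assms[unfolded partial_deriv_def]] by (rule UN_E)
  then have "m = m' - Poly_Mapping.single \<delta> 1" "Poly_Mapping.lookup m' \<delta> \<noteq> 0"
    by (auto split: if_splits)
  then have "m' = m + Poly_Mapping.single \<delta> 1"
    by (intro poly_mapping_eqI) (auto simp: lookup_add lookup_minus lookup_single when_def)
  then show ?thesis using m' by blast
qed

lemma mon_deg_add: "mon_deg n (m + m') = mon_deg n m + mon_deg n m'"
  by (simp add: mon_deg_def lookup_add sum.distrib)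

lemma mon_height_add: "mon_height n (m + m') = mon_height n m + mon_height n m'"
  by (simp add: mon_height_def lookup_add sum.distrib algebra_simps)

lemma mon_deg_single: "\<gamma> \<in> pos_roots n \<Longrightarrow> mon_deg n (Poly_Mapping.single \<gamma> 1) = 1"
  by (simp add: mon_deg_def lookup_single when_def finite_pos_roots)

lemma mon_height_single:
  assumes "\<gamma> \<in> pos_roots n"
  shows "mon_height n (Poly_Mapping.single \<gamma> 1) = snd \<gamma> - fst \<gamma>"
proof -
  have "mon_height n (Poly_Mapping.single \<gamma> 1) =
      (\<Sum>\<delta>\<in>pos_roots n. if \<delta> = \<gamma> then snd \<gamma> - fst \<gamma> else 0)"
    unfolding mon_height_def by (intro sum.cong) (auto simp: lookup_single when_def)
  then show ?thesis using assms by (simp add: finite_pos_roots)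
qed

text \<open>Bracketing with \<open>Y \<gamma>\<close> trades one factor \<open>Y \<delta>\<close>
  for a \<open>Y \<beta>\<close> occurring in the commutator. The trade is written as an equation of
  sums because subtraction of monomials is truncated.\<close>

lemma keys_poisson_Y:
  assumes "m \<in> Poly_Mapping.keys (poisson n (Y \<gamma>) p)"
  shows "\<exists>m'\<in>Poly_Mapping.keys p. \<exists>\<delta>\<in>pos_roots n. \<exists>\<beta>\<in>pos_roots n.
    m + Poly_Mapping.single \<delta> 1 = m' + Poly_Mapping.single \<beta> 1 \<and>
    snd \<beta> - fst \<beta> > snd \<delta> - fst \<delta>"
proof -
  have pd: "partial_deriv \<alpha> (Y \<gamma>) = (if \<alpha> = \<gamma> then 1 else 0)" for \<alpha>
    by (auto simp: partial_deriv_def Y_def lookup_single when_def)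
  obtain \<alpha> where "\<alpha> \<in> pos_roots n" "m \<in> Poly_Mapping.keys (\<Sum>\<delta>\<in>pos_roots n.
      partial_deriv \<alpha> (Y \<gamma>) * partial_deriv \<delta> p *
      lin_poly n (lie (y_unit n \<alpha>) (y_unit n \<delta>)))"
    using subsetD[OF keys_sum assms[unfolded poisson_def]] by (rule UN_E)
  moreover from subsetD[OF keys_sum this(2)] obtain \<delta> where "\<delta> \<in> pos_roots n"
    "m \<in> Poly_Mapping.keys (partial_deriv \<alpha> (Y \<gamma>) *
      partial_deriv \<delta> p * lin_poly n (lie (y_unit n \<alpha>) (y_unit n \<delta>)))"
    by (rule UN_E)
  \<comment> \<open>Only the summand with \<alpha> = \<gamma> is nonzero; this also yields that
    \<gamma> is a positive root.\<close>
  ultimately obtain \<delta> where \<delta>: "\<delta> \<in> pos_roots n" and \<gamma>: "\<gamma> \<in> pos_roots n" and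
    m: "m \<in> Poly_Mapping.keys (partial_deriv \<delta> p * lin_poly n (lie (y_unit n \<gamma>) (y_unit n \<delta>)))"
    by (auto simp: pd split: if_splits)
  then obtain a b where ab: "m = a + b" "a \<in> Poly_Mapping.keys (partial_deriv \<delta> p)"
      "b \<in> Poly_Mapping.keys (lin_poly n (lie (y_unit n \<gamma>) (y_unit n \<delta>) :: 'a mat))"
    using keys_mult by blast
  from keys_partial_deriv[OF ab(2)] keys_lin_poly[OF ab(3)] obtain \<beta> where
    "a + Poly_Mapping.single \<delta> 1 \<in> Poly_Mapping.keys p"
    and \<beta>: "\<beta> \<in> pos_roots n" "b = Poly_Mapping.single \<beta> 1"
      "coord (lie (y_unit n \<gamma>) (y_unit n \<delta>) :: 'a mat) \<beta> \<noteq> 0" by blast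
  moreover have "snd \<beta> - fst \<beta> > snd \<delta> - fst \<delta>"
    using lie_y_unit_coord[OF \<gamma> \<delta> \<beta>(1,3)] \<gamma> by (auto simp: pos_roots_def)
  ultimately show ?thesis
    using \<delta> ab(1) by (intro bexI[of _ "a + Poly_Mapping.single \<delta> 1"] bexI[of _ \<delta>] bexI[of _ \<beta>])
      (auto simp: ac_simps)
qed

lemma poisson_Y_graded:
  assumes p: "p \<in> graded n d h"
  shows "poisson n (Y \<gamma>) p \<in> graded n d (Suc h)"
proof -
  have "Poly_Mapping.keys m \<subseteq> pos_roots n \<and> mon_deg n m \<le> d \<and> Suc h \<le> mon_height n m"
    if m: "m \<in> Poly_Mapping.keys (poisson n (Y \<gamma>) p)" for m
  proof -
    obtain m' \<delta> \<beta> where m': "m' \<in> Poly_Mapping.keys p" "\<delta> \<in> pos_roots n" "\<beta> \<in> pos_roots n"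
      and eq: "m + Poly_Mapping.single \<delta> 1 = m' + Poly_Mapping.single \<beta> 1"
      and less: "snd \<beta> - fst \<beta> > snd \<delta> - fst \<delta>"
      using keys_poisson_Y[OF m] by blast
    \<comment> \<open>Degree and height are additive, so both can be read off the equation of the
      trade.\<close>
    have deg: "mon_deg n m = mon_deg n m'"
      using arg_cong[OF eq, of "mon_deg n"] m' by (simp add: mon_deg_add mon_deg_single del: One_nat_def)
    have ht: "mon_height n m' < mon_height n m"
      using arg_cong[OF eq, of "mon_height n"] m' less
      by (simp add: mon_height_add mon_height_single del: One_nat_def)
    have "x \<in> pos_roots n" if "x \<in> Poly_Mapping.keys m" for x
    proof -
      have "Poly_Mapping.lookup (m' + Poly_Mapping.single \<beta> 1) x \<noteq> 0"
        unfolding eq[symmetric] using that by (simp add: lookup_add in_keys_iff)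
      then have "x \<in> Poly_Mapping.keys m' \<or> x = \<beta>"
        by (auto simp: lookup_add in_keys_iff lookup_single when_def split: if_splits)
      then show ?thesis using m' p by (auto simp: graded_def pol_iff)
    qed
    moreover have "mon_deg n m' \<le> d" "h \<le> mon_height n m'" using p m' by (auto simp: graded_def)
    ultimately show ?thesis using deg ht by auto
  qed
  then show ?thesis by (auto simp: graded_def pol_iff)
qed

lemma graded_exists:
  assumes "p \<in> pol (pos_roots n)"
  shows "\<exists>d. p \<in> graded n d 0"
  \<comment> \<open>The sum of all degrees bounds each of them.\<close>
  using assms by (intro exI[of _ "\<Sum>m\<in>Poly_Mapping.keys p. mon_deg n m"])
    (auto simp: graded_def intro: member_le_sum)

lemma poisson_Y_funpow_graded:
  "p \<in> graded n d 0 \<Longrightarrow> (poisson n (Y \<gamma>) ^^ s) p \<in> graded n d s"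
  by (induction s) (auto intro: poisson_Y_graded)

lemma exp_ad_fiber:
  assumes p: "p \<in> fiber (pos_roots n) v r" and q: "q \<in> fiber (pos_roots n) v 0"
  shows "exp_ad n (Y \<gamma>) q p \<in> fiber (pos_roots n) v r"
proof -
  obtain d where d: "p \<in> graded n d 0" using p graded_exists by blast
  let ?f = "\<lambda>s. Const ((-1) ^ s / fact s) * (poisson n (Y \<gamma>) ^^ s) p * q ^ s"
  \<comment> \<open>Each bracket raises the height bound by one while the degree stays at most
    \<open>d\<close>, so the series stops at \<open>n * d\<close>.\<close>
  have zero: "(poisson n (Y \<gamma>) ^^ s) p = 0" if "s > n * d" for s
    using poisson_Y_funpow_graded[OF d] graded_eq_0 that by blast
  have "exp_ad n (Y \<gamma>) q p = (\<Sum>s\<in>{0..n * d}. ?f s)"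
    unfolding exp_ad_def
  proof (rule Sum_any.expand_superset)
    show "{s. ?f s \<noteq> 0} \<subseteq> {0..n * d}"
      using zero by (auto simp: not_le intro: ccontr)
  qed simp
  moreover have "(\<Sum>s\<in>{0..n * d}. ?f s) \<in> pol (pos_roots n)"
    using p q poisson_Y_funpow_graded[OF d]
    by (intro pol_sum pol_mult pol_power pol_Const) (auto simp: graded_def)
  \<comment> \<open>Since \<open>ev v q = 0\<close>, every term with \<open>s > 0\<close> vanishes;
    the term \<open>s = 0\<close> is \<open>p\<close> itself.\<close>
  moreover have "ev v (\<Sum>s\<in>{0..n * d}. ?f s) = (\<Sum>s\<in>{0..n * d}. if s = 0 then r else 0)"
    unfolding ev_sum by (rule sum.cong) (use p q in \<open>auto simp: zero_power\<close>)
  ultimately show ?thesis by simp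
qed


section \<open>Combinatorics of admissible sets\<close>

text \<open>Larger roots play the role of smaller elements, so results on increasing lists speak of
  the decreasing enumeration.\<close>

interpretation root_order: linorder "\<lambda>\<gamma> \<delta>. \<gamma> = \<delta> \<or> root_gt \<gamma> \<delta>" root_gt
  by unfold_locales (auto simp: root_gt_def)

text \<open>Existence and uniqueness of the sorted list make the definite description
  meaningful.\<close>

lemma enum_desc:
  assumes "finite S"
  shows "sorted_wrt root_gt (enum_desc S) \<and> set (enum_desc S) = S"
  unfolding enum_desc_def
proof (rule theI')
  show "\<exists>!xs. sorted_wrt root_gt xs \<and> set xs = S"
    using root_order.sorted_list_of_set.finite_set_strict_sorted[OF assms]
      root_order.strict_sorted_equal by metis
qed

lemma length_enum_desc:
  assumes "finite S"
  shows "length (enum_desc S) = card S"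
proof -
  have "distinct (enum_desc S)"
    using enum_desc[OF assms] root_order.strict_sorted_iff by blast
  then show ?thesis
    using distinct_card enum_desc[OF assms] by metis
qed

lemma nth_root_mem:
  assumes "finite S" "i \<in> {1..card S}"
  shows "nth_root S i \<in> S"
proof -
  have "i - 1 < length (enum_desc S)"
    using assms(2) unfolding length_enum_desc[OF assms(1)] by auto
  then have "nth_root S i \<in> set (enum_desc S)"
    unfolding nth_root_def by (rule nth_mem)
  then show ?thesis
    using enum_desc[OF assms(1)] by blast
qed

lemma nth_root_gt:
  assumes "finite S" "1 \<le> r" "r < i" "i \<le> card S"
  shows "root_gt (nth_root S r) (nth_root S i)"
  unfolding nth_root_def
proof (rule sorted_wrt_nth_less)
  show "sorted_wrt root_gt (enum_desc S)"
    using enum_desc[OF assms(1)] by blast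
  show "i - 1 < length (enum_desc S)" "r - 1 < i - 1"
    using assms(2-4) length_enum_desc[OF assms(1)] by simp_all
qed

text \<open>The recursion proper begins at index 1; the value of \<open>A_seq\<close> at 0 is a
  filler.\<close>

lemma A_seq_step: "1 \<le> i \<Longrightarrow> A_seq n S (Suc i) = A_seq n S i - C_set (nth_root S i) (A_seq n S i)"
  by (cases i) auto

lemma A_seq_subset: "A_seq n S i \<subseteq> pos_roots n"
  by (induction n S i rule: A_seq.induct) auto

lemma A_seq_antimono:
  assumes "1 \<le> i" "i \<le> j"
  shows "A_seq n S j \<subseteq> A_seq n S i"
  using assms(2,1) by (induction j rule: dec_induct) (auto simp: A_seq_step)

section \<open>The indices \<open>m_idx\<close> and the sets \<open>B_set\<close>\<close>

lemma m_idx_le: "m_idx n S t \<le> card S + 1"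
  unfolding m_idx_def by auto

lemma m_idx_ge_1: "1 \<le> m_idx n S t"
  by (simp add: m_idx_def)

text \<open>Used in contraposition: from index \<open>m_idx n S t\<close> on, no root of
  \<open>S\<close> lies in a row before \<open>t\<close>.\<close>

lemma less_m_idx:
  assumes "r \<in> {1..card S}" "nth_root S r \<in> row n u" "1 \<le> u" "u < t"
  shows "r < m_idx n S t"
proof -
  have "r \<le> Max ({0} \<union> {r \<in> {1..card S}. nth_root S r \<in> (\<Union>u\<in>{1..<t}. row n u)})"
    using assms by (intro Max_ge) auto
  then show ?thesis by (simp add: m_idx_def)
qed

lemma B_set_subset: "B_set n S t \<subseteq> pos_roots n"
  using A_seq_subset by (auto simp: B_set_def)

text \<open>This places the generators of row \<open>t\<close> in the algebra where their ideal is
  formed.\<close>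

lemma A_fin_row_subset: "A_fin n S \<inter> row n t \<subseteq> B_set n S t"
proof -
  have "A_fin n S \<subseteq> A_seq n S (m_idx n S t)"
    unfolding A_fin_def by (rule A_seq_antimono[OF m_idx_ge_1 m_idx_le])
  then show ?thesis by (auto simp: B_set_def row_def pos_roots_def)
qed

section \<open>Decompositions of a root into two roots\<close>

lemma root_sumD:
  assumes "root_sum \<gamma> \<delta> \<xi>" "fst \<gamma> < snd \<gamma>" "fst \<delta> < snd \<delta>" "fst \<xi> < snd \<xi>"
  shows "(fst \<gamma> = fst \<xi> \<and> snd \<gamma> = fst \<delta> \<and> snd \<delta> = snd \<xi>) \<or>
    (fst \<delta> = fst \<xi> \<and> snd \<delta> = fst \<gamma> \<and> snd \<gamma> = snd \<xi>)"
proof -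
  obtain j i t s a b where eq: "\<gamma> = (j, i)" "\<delta> = (t, s)" "\<xi> = (a, b)"
    by (metis surj_pair)
  have *: "root_vec \<gamma> k + root_vec \<delta> k = root_vec \<xi> k" for k
    using assms by (simp add: root_sum_def)
  have lt: "j < i" "t < s" "a < b" using assms(2-4) by (auto simp: eq)
  show ?thesis
  \<comment> \<open>If \<open>i = t\<close>, the middle index cancels. Otherwise the negative
    coefficient at \<open>i\<close> and the positive one at \<open>t\<close> survive, forcing
    \<open>i = b\<close> and \<open>t = a\<close>.\<close>
  proof (cases "i = t")
    case True
    then show ?thesis
      using *[of j] *[of s] lt by (simp add: eq root_vec_def split: if_splits)
  next
    case False
    then have "i = b" using *[of i] lt by (simp add: eq root_vec_def split: if_splits)
    moreover from this have "t = a" "t \<noteq> j"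
      using *[of t] lt False by (simp_all add: eq root_vec_def split: if_splits)
    moreover from calculation have "j = s"
      using *[of j] lt by (simp add: eq root_vec_def split: if_splits)
    ultimately show ?thesis by (simp add: eq)
  qed
qed

lemma root_diff_eq:
  assumes "j < k" "k < i"
  shows "root_diff (j, i) (j, k) = (k, i)"
  unfolding root_diff_def
proof (rule the_equality)
  show "root_sum (j, k) (k, i) (j, i)"
    by (auto simp: root_sum_def root_vec_def)
  \<comment> \<open>Here \<delta> is an arbitrary pair; the coefficients 1 at \<open>k\<close> and
    -1 at \<open>i\<close> determine both entries.\<close>
  fix \<delta> assume "root_sum (j, k) \<delta> (j, i)"
  then have *: "root_vec \<delta> l = root_vec (k, i) l" for l
    by (auto simp: root_sum_def root_vec_def algebra_simps dest!: spec[of _ l])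
  obtain a b where \<delta>: "\<delta> = (a, b)" by (metis surj_pair)
  show "\<delta> = (k, i)"
    using *[of k] *[of i] assms by (auto simp: \<delta> root_vec_def split: if_splits)
qed

text \<open>Of two positive roots with sum \<xi>, one starts in the row of \<xi> and the other in a
  later row. The order compares rows first, so \<open>C_plus\<close> selects the former.\<close>

lemma C_plusD:
  assumes "\<gamma> \<in> C_plus \<xi> (B_set n S t)" "\<xi> \<in> row n t"
  shows "\<gamma> \<in> C_set \<xi> (B_set n S t)" "\<gamma> \<in> row n t" "root_diff \<xi> \<gamma> \<notin> row n t"
proof -
  show C: "\<gamma> \<in> C_set \<xi> (B_set n S t)"
    using assms by (auto simp: C_plus_def C_set_def)
  obtain \<delta> where \<delta>: "\<delta> \<in> B_set n S t" "root_sum \<gamma> \<delta> \<xi>" "root_gt \<gamma> \<delta>" and \<gamma>: "\<gamma> \<in> B_set n S t"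
    using assms by (auto simp: C_plus_def)
  obtain j i k s a b where eq: "\<gamma> = (j, i)" "\<delta> = (k, s)" "\<xi> = (a, b)"
    by (metis surj_pair)
  have lt: "j < i" "k < s" "a < b" and a: "a = t"
    using \<gamma> \<delta>(1) assms(2) by (auto simp: eq B_set_def row_def pos_roots_def)
  have *: "j = t \<and> i = k \<and> s = b"
    using root_sumD[OF \<delta>(2)] lt \<delta>(3) a by (auto simp: eq root_gt_def)
  show "\<gamma> \<in> row n t"
    using \<gamma> B_set_subset[of n S t] * by (auto simp: eq row_def)
  have "root_diff \<xi> \<gamma> = (i, b)"
    unfolding eq using root_diff_eq[of j i b] * lt a by simp
  then show "root_diff \<xi> \<gamma> \<notin> row n t"
    using * lt by (auto simp: row_def)
qed

text \<open>Between the index \<open>m(t)\<close> and the index of \<open>\<xi>\<close> only roots of row \<open>t\<close> in \<open>S\<^sub>\<box>\<close> occur, and these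
  leave \<open>A\<^sub>i\<close> unchanged; so \<open>\<xi>\<close> removes all of \<open>C(\<xi>, B\<^sub>t)\<close>.\<close>

lemma C_set_disjoint_A_fin:
  assumes fin: "finite S" "S \<subseteq> pos_roots n"
    and \<xi>: "S_tens n S \<inter> row n t = {\<xi>}" and \<gamma>: "\<gamma> \<in> C_set \<xi> (B_set n S t)"
  shows "\<gamma> \<notin> A_fin n S"
proof -
  obtain i where i: "i \<in> {1..card S}" "\<xi> = nth_root S i"
    using \<xi> by (auto simp: S_tens_def)
  have row: "\<xi> \<in> row n t" using \<xi> by blast
  let ?m = "m_idx n S t"
  \<comment> \<open>Every splitting of \<xi> inside \<open>B_set n S t\<close> must still be
    available when \<xi> is processed.\<close>
  have "A_seq n S ?m \<subseteq> A_seq n S i"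
  proof (cases "i \<le> ?m")
    case True
    then show ?thesis using i by (intro A_seq_antimono) auto
  next
    case False
    have "A_seq n S ?m \<subseteq> A_seq n S r" if "?m \<le> r" "r \<le> i" for r
      using that
    proof (induction r rule: dec_induct)
      case (step r)
      have r: "r \<in> {1..card S}" "r < i" using step i m_idx_ge_1[of n S t] by auto
      have gt: "root_gt (nth_root S r) \<xi>"
        using nth_root_gt[OF fin(1)] r i by auto
      have pos: "nth_root S r \<in> pos_roots n" using nth_root_mem fin r by blast
      \<comment> \<open>As \<open>r\<close> is at least \<open>m_idx n S t\<close>, this root is not
        in an earlier row; as it precedes \<xi>, it is not in a later one.\<close>
      have "nth_root S r \<in> row n (fst (nth_root S r))" using pos by (auto simp: row_def)
      then have "\<not> fst (nth_root S r) < t"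
        using less_m_idx[OF r(1)] step(1) pos by (fastforce simp: pos_roots_def)
      then have "nth_root S r \<in> row n t"
        using gt pos row by (auto simp: root_gt_def row_def)
      moreover have "nth_root S r \<noteq> \<xi>" using gt by (auto simp: root_gt_def)
      ultimately have "nth_root S r \<notin> S_tens n S" using \<xi> by blast
      then have "C_set (nth_root S r) (A_seq n S r) = {}"
        using r by (auto simp: S_tens_def)
      then show ?case using step r by (simp add: A_seq_step)
    qed simp
    then show ?thesis using False by simp
  qed
  then have "\<gamma> \<in> C_set \<xi> (A_seq n S i)"
    using \<gamma> by (auto simp: C_set_def B_set_def)
  \<comment> \<open>The root \<gamma> is dropped at step \<open>i\<close>, and the sets only shrink
    afterwards.\<close>
  then have "\<gamma> \<notin> A_seq n S (Suc i)"
    using i by (simp add: A_seq_step)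
  moreover have "A_fin n S \<subseteq> A_seq n S (Suc i)"
    unfolding A_fin_def using i by (intro A_seq_antimono) auto
  ultimately show ?thesis by blast
qed

section \<open>The maps preserve evaluation at the canonical form\<close>

text \<open>Evaluation with \<open>eval_at\<close> at the canonical form unfolds to
  \<open>ev (canon_val n S c)\<close>.\<close>

definition canon_val :: "nat \<Rightarrow> root set \<Rightarrow> (root \<Rightarrow> 'k) \<Rightarrow> root \<Rightarrow> 'k::field_char_0" where
  "canon_val n S c \<gamma> = canonical_form n S c (y_unit n \<gamma>)"

lemma canon_val:
  "\<gamma> \<in> pos_roots n \<Longrightarrow> canon_val n S c \<gamma> = (if \<gamma> \<in> A_fin n S then c_ext S c \<gamma> else 0)"
  by (simp add: canon_val_def canonical_form_y_unit)

text \<open>\<open>B\<close> is left open, since the generators occur both over \<open>B_set\<close>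
  and over the smaller \<open>B_step\<close>.\<close>

lemma row_gens_fiber:
  assumes "A_fin n S \<inter> row n t \<subseteq> B"
  shows "row_gens n S c t \<subseteq> fiber B (canon_val n S c) 0"
proof
  fix p assume "p \<in> row_gens n S c t"
  then obtain \<gamma> where \<gamma>: "p = Y \<gamma> - Const (c_ext S c \<gamma>)" "\<gamma> \<in> A_fin n S" "\<gamma> \<in> row n t"
    by (auto simp: row_gens_def)
  then have "\<gamma> \<in> pos_roots n" "\<gamma> \<in> B" using assms by (auto simp: row_def)
  then show "p \<in> fiber B (canon_val n S c) 0"
    using \<gamma> by (auto simp: canon_val)
qed

lemma fiber_mono: "B \<subseteq> B' \<Longrightarrow> fiber B v r \<subseteq> fiber B' v r"
  using pol_mono by blast

lemma I_ideal_fiber: "I_ideal n S c t \<subseteq> fiber (pos_roots n) (canon_val n S c) 0"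
  unfolding I_ideal_def
  using Idl_subset_fiber_0[OF row_gens_fiber[OF A_fin_row_subset]] fiber_mono[OF B_set_subset]
  by blast

lemma gam_mem:
  assumes "i \<in> {1..card (C_plus \<xi> (B_set n S t))}"
  shows "gam n S t \<xi> i \<in> C_plus \<xi> (B_set n S t)"
proof -
  have "finite (C_plus \<xi> (B_set n S t))"
    by (rule finite_subset[OF _ finite_pos_roots[of n]])
      (use B_set_subset in \<open>auto simp: C_plus_def\<close>)
  then show ?thesis using assms unfolding gam_def by (rule nth_root_mem)
qed

lemma gam_val:
  assumes "finite S" "S \<subseteq> pos_roots n" "S_tens n S \<inter> row n t = {\<xi>}"
    and "i \<in> {1..card (C_plus \<xi> (B_set n S t))}"
  shows "gam n S t \<xi> i \<in> row n t" "canon_val n S c (gam n S t \<xi> i) = 0"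
proof -
  have \<xi>: "\<xi> \<in> row n t" using assms(3) by blast
  show row: "gam n S t \<xi> i \<in> row n t"
    using C_plusD(2)[OF gam_mem[OF assms(4)] \<xi>] .
  have "gam n S t \<xi> i \<notin> A_fin n S"
    using C_set_disjoint_A_fin[OF assms(1-3) C_plusD(1)[OF gam_mem[OF assms(4)] \<xi>]] .
  then show "canon_val n S c (gam n S t \<xi> i) = 0"
    using row by (auto simp: canon_val row_def)
qed

lemma I_step_fiber:
  assumes "finite S" "S \<subseteq> pos_roots n" "S_tens n S \<inter> row n t = {\<xi>}"
    and m: "m \<le> card (C_plus \<xi> (B_set n S t))"
  shows "I_step n S c t \<xi> m \<subseteq> fiber (pos_roots n) (canon_val n S c) 0"
proof -
  have \<xi>: "\<xi> \<in> row n t" using assms(3) by blast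
  \<comment> \<open>The removed roots \<gamma>' lie outside row \<open>t\<close>, so the generators
    stay in the smaller algebra.\<close>
  have row: "B_set n S t \<inter> row n t \<subseteq> B_step n S t \<xi> m"
    using C_plusD(3)[OF gam_mem \<xi>] m by (force simp: B_step_def gam'_def)
  have "row_gens n S c t \<subseteq> fiber (B_step n S t \<xi> m) (canon_val n S c) 0"
    using row A_fin_row_subset[of n S t] by (intro row_gens_fiber) blast
  moreover have "Y (gam n S t \<xi> i) \<in> fiber (B_step n S t \<xi> m) (canon_val n S c) 0"
    if "i \<in> {1..m}" for i
  proof -
    have i: "i \<in> {1..card (C_plus \<xi> (B_set n S t))}" using that m by auto
    have "gam n S t \<xi> i \<in> B_set n S t" using gam_mem[OF i] by (auto simp: C_plus_def)
    then show ?thesis using gam_val[OF assms(1-3) i] row by auto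
  qed
  ultimately have "I_step n S c t \<xi> m \<subseteq> fiber (B_step n S t \<xi> m) (canon_val n S c) 0"
    unfolding I_step_def by (intro Idl_subset_fiber_0) blast
  moreover have "B_step n S t \<xi> m \<subseteq> pos_roots n"
    using B_set_subset by (auto simp: B_step_def)
  ultimately show ?thesis using fiber_mono by blast
qed

lemma theta_comp_fiber:
  assumes "finite S" "S \<subseteq> pos_roots n" "S_tens n S \<inter> row n t = {\<xi>}"
    and "m \<le> card (C_plus \<xi> (B_set n S t))" "X \<subseteq> fiber (pos_roots n) (canon_val n S c) r"
  shows "theta_comp n S c t \<xi> m X \<subseteq> fiber (pos_roots n) (canon_val n S c) r"
  using assms(4,5)
\<comment> \<open>The map with the highest index is applied first, so the induction hypothesis is
  needed for its image instead of \<open>X\<close>.\<close>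
proof (induction m arbitrary: X)
  case (Suc m)
  have m: "Suc m \<in> {1..card (C_plus \<xi> (B_set n S t))}" using Suc by auto
  have q: "Const (inverse (c \<xi>)) * Y (gam n S t \<xi> (Suc m)) \<in>
      fiber (pos_roots n) (canon_val n S c) 0"
    using gam_val[OF assms(1-3) m] by (auto simp: row_def)
  have "theta_step n S c t \<xi> (Suc m) X \<subseteq> fiber (pos_roots n) (canon_val n S c) r"
    unfolding theta_step_def
  proof (rule UN_least)
    fix a assume "a \<in> X"
    then have "a \<in> fiber (pos_roots n) (canon_val n S c) r" using Suc by blast
    from exp_ad_fiber[OF this q] I_step_fiber[OF assms(1-3), of m] Suc(2)
    show "I_step n S c t \<xi> (Suc m - 1) +>\<^bsub>sym_alg (B_step n S t \<xi> (Suc m - 1))\<^esub>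
        exp_ad n (Y (gam' n S t \<xi> (Suc m)))
          (Const (inverse (c \<xi>)) * Y (gam n S t \<xi> (Suc m))) a
      \<subseteq> fiber (pos_roots n) (canon_val n S c) r"
      by (intro coset_subset_fiber) auto
  qed
  then show ?case using Suc by simp
qed simp

lemma case2ii_subst_fiber:
  assumes "p \<in> fiber (pos_roots 7) (canon_val 7 S_ii c) r"
  shows "case2ii_subst c p \<in> fiber (pos_roots 7) (canon_val 7 S_ii c) r"
proof -
  let ?w = "\<lambda>\<gamma>. if \<gamma> = (5, 6)
    then Y (5, 6) - Const (inverse (c (4, 7))) * Y (5, 7) * Y (4, 6) else Y \<gamma>"
  \<comment> \<open>\<open>c_ext\<close> vanishes off \<open>S_ii\<close>, so the value is 0 whether
    or not \<open>(5, 7)\<close> lies in \<open>A_fin 7 S_ii\<close>.\<close>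
  have "canon_val 7 S_ii c (5, 7) = 0"
    by (simp add: canon_val pos_roots_def c_ext_def S_ii_def)
  then have "ev (canon_val 7 S_ii c) (?w \<gamma>) = canon_val 7 S_ii c \<gamma>" for \<gamma>
    by simp
  moreover have "?w \<gamma> \<in> pol (pos_roots 7)" if "\<gamma> \<in> pos_roots 7" for \<gamma>
  proof -
    have "Y (5, 6) - Const (inverse (c (4, 7))) * Y (5, 7) * Y (4, 6) \<in> pol (pos_roots 7)"
      by (intro pol_diff pol_mult pol_Const) (simp_all add: pos_roots_def)
    then show ?thesis using that by simp
  qed
  then have "case2ii_subst c p \<in> pol (pos_roots 7)"
    unfolding case2ii_subst_def using assms by (intro pol_subst_poly[of p "pos_roots 7"]) blast+
  ultimately show ?thesis
    using assms by (simp add: case2ii_subst_def ev_subst_poly)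
qed

text \<open>Letting \<open>a\<close> be any polynomial over \<open>pos_roots n\<close> allows the
  maps for successive \<open>t\<close> to be chained without tracking the subalgebras.\<close>

lemma theta_fiber:
  assumes "finite S" "S \<subseteq> pos_roots n" and a: "a \<in> fiber (pos_roots n) (canon_val n S c) r"
  shows "theta n S c t a \<subseteq> fiber (pos_roots n) (canon_val n S c) r"
proof (cases "\<exists>\<xi>. S_tens n S \<inter> row n t = {\<xi>} \<and> (\<forall>\<eta>\<in>S_box n S \<inter> row n t. root_gt \<eta> \<xi>)")
  case True
  then obtain \<xi> where \<xi>: "S_tens n S \<inter> row n t = {\<xi>}" by blast
  have "theta n S c t a = theta_case1 n S c t \<xi> a"
    using True \<xi> by (auto simp: theta_def)
  also have "\<dots> \<subseteq> fiber (pos_roots n) (canon_val n S c) r"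
    unfolding theta_case1_def Let_def
    by (intro theta_comp_fiber[OF assms(1,2) \<xi>] order_refl
        coset_subset_fiber[OF I_step_fiber[OF assms(1,2) \<xi> order_refl] a])
  finally show ?thesis .
next
  case False
  show ?thesis
  proof (cases "n = 7 \<and> t = 4 \<and> S = S_ii")
    case True
    have "case2ii_subst c a \<in> fiber (pos_roots n) (canon_val n S c) r"
      using case2ii_subst_fiber a True by blast
    from coset_subset_fiber[OF I_ideal_fiber this] show ?thesis
      unfolding theta_def if_not_P[OF False] if_P[OF True] .
  next
    case neither: False
    from coset_subset_fiber[OF I_ideal_fiber a] show ?thesis
      unfolding theta_def if_not_P[OF False] if_not_P[OF neither] .
  qed
qed

text \<open>The two claims need each other: the next ideal is generated using values of the current
  map, and the values of the next map are built from cosets of the next ideal.\<close>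

lemma calI_Theta_fiber:
  assumes S: "finite S" "S \<subseteq> pos_roots n"
  shows "fst (calI_Theta n S c t) \<subseteq> fiber (pos_roots n) (canon_val n S c) 0 \<and>
    (\<forall>r. \<forall>a\<in>fiber (pos_roots n) (canon_val n S c) r.
       snd (calI_Theta n S c t) a \<subseteq> fiber (pos_roots n) (canon_val n S c) r)"
proof (induction t)
  case 0
  show ?case
    unfolding calI_Theta.simps fst_conv snd_conv
    by (intro conjI allI ballI I_ideal_fiber theta_fiber[OF S])
next
  case (Suc t)
  let ?F = "fiber (pos_roots n) (canon_val n S c)"
  let ?I = "fst (calI_Theta n S c t)" and ?T = "snd (calI_Theta n S c t)"
  have T: "?T a \<subseteq> ?F r" if "a \<in> ?F r" for a r using Suc that by blast
  have "\<Union> (?T ` I_ideal n S c (t + 2)) \<subseteq> ?F 0"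
    using T I_ideal_fiber by blast
  then have I: "fst (calI_Theta n S c (Suc t)) \<subseteq> ?F 0"
    unfolding calI_Theta.simps Let_def fst_conv
    by (intro Idl_subset_fiber_0 Un_least conjunct1[OF Suc])
  moreover have "snd (calI_Theta n S c (Suc t)) a \<subseteq> ?F r" if a: "a \<in> ?F r" for a r
  proof -
    \<comment> \<open>The next map runs over representatives \<open>b\<close> and then
      \<open>d\<close>; both keep the value \<open>r\<close>.\<close>
    have "fst (calI_Theta n S c (Suc t)) +>\<^bsub>sym_alg (pos_roots n)\<^esub> d \<subseteq> ?F r"
      if "b \<in> theta n S c (t + 2) a" "d \<in> ?T b" for b d
    proof (rule coset_subset_fiber[OF I])
      have "b \<in> ?F r" using theta_fiber[OF S a] that(1) by blast
      then show "d \<in> ?F r" using T that(2) by blast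
    qed
    moreover have "snd (calI_Theta n S c (Suc t)) a = (\<Union>b\<in>theta n S c (t + 2) a. \<Union>d\<in>?T b.
        fst (calI_Theta n S c (Suc t)) +>\<^bsub>sym_alg (pos_roots n)\<^esub> d)"
      unfolding calI_Theta.simps Let_def fst_conv snd_conv ..
    ultimately show ?thesis by (simp only: UN_subset_iff) blast
  qed
  ultimately show ?case by (intro conjI allI ballI)
qed

section \<open>Linearity of the canonical form\<close>

lemma canonical_form_ut_dual: "canonical_form n S c \<in> ut_dual n"
proof -
  have carrier: "x \<in> carrier_mat n n" if "x \<in> ut n" for x :: "'a mat"
    using that by (simp add: ut_def)
  have idx: "snd \<gamma> - 1 < n" "fst \<gamma> - 1 < n" if "\<gamma> \<in> pos_roots n" for \<gamma>
    using that by (auto simp: pos_roots_def)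
  have add: "coord (x + y) \<gamma> = coord x \<gamma> + coord y \<gamma>"
    if "x \<in> ut n" "y \<in> ut n" "\<gamma> \<in> pos_roots n" for x y :: "'a mat" and \<gamma>
    using carrier[OF that(1)] carrier[OF that(2)] idx[OF that(3)]
    by (simp add: coord_def case_prod_beta)
  have smult: "coord (r \<cdot>\<^sub>m x) \<gamma> = r * coord x \<gamma>"
    if "x \<in> ut n" "\<gamma> \<in> pos_roots n" for x :: "'a mat" and r \<gamma>
    using carrier[OF that(1)] idx[OF that(2)] by (simp add: coord_def case_prod_beta)
  \<comment> \<open>The form is \<open>undefined\<close> outside \<open>ut n\<close>, so sums and
    multiples must be known to stay inside.\<close>
  have closed_add: "x + y \<in> ut n" if "x \<in> ut n" "y \<in> ut n" for x y :: "'a mat"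
    using that by (auto simp: ut_def)
  have closed_smult: "r \<cdot>\<^sub>m x \<in> ut n" if "x \<in> ut n" for x :: "'a mat" and r
    using that by (auto simp: ut_def)
  show ?thesis
    unfolding ut_dual_def
  proof (intro CollectI conjI ballI allI)
    show "canonical_form n S c \<in> extensional (ut n)"
      by (simp add: canonical_form_def)
    show "canonical_form n S c (x + y) = canonical_form n S c x + canonical_form n S c y"
      if "x \<in> ut n" "y \<in> ut n" for x y
      using that by (simp add: canonical_form_def closed_add add distrib_left sum.distrib
          cong: sum.cong)
    show "canonical_form n S c (r \<cdot>\<^sub>m x) = r * canonical_form n S c x" if "x \<in> ut n" for r x
      using that by (simp add: canonical_form_def closed_smult smult sum_distrib_left mult_ac
          cong: sum.cong)
  qed
qed

theorem theorem1p10: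
  fixes n :: nat and S :: "root set" and c :: "root \<Rightarrow> 'k::field_char_0"
  assumes "2 \<le> n" and "n \<le> 7"
    and "(S, c) \<in> max_admissible_pairs n"
  shows "canonical_form n S c \<in> Omega n S c"
proof -
  have S: "S \<subseteq> pos_roots n"
    using assms(3) by (auto simp: max_admissible_pairs_def max_admissible_def admissible_def)
  then have "finite S" using finite_pos_roots finite_subset by blast
  \<comment> \<open>\<open>calI\<close> is stage \<open>n - 2\<close>, since stage \<open>t\<close>
    carries the ideal with index \<open>t + 1\<close>.\<close>
  then have "calI n S c \<subseteq> fiber (pos_roots n) (canon_val n S c) 0"
    using calI_Theta_fiber[OF _ S] unfolding calI_def by blast
  then show ?thesis
    using canonical_form_ut_dual unfolding Omega_def eval_at_def canon_val_def[abs_def] by blast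
qed

end
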